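(* Let $(X,d)$ be a compact metric space such that for each $\epsilon>0$ there is a retraction $r_\epsilon: X\to Y_\epsilon$ onto a subspace $Y_\epsilon=r_\epsilon(X)\subset X$ with $\hat d(r_\epsilon,\mathrm{id}_X)<\epsilon$ and $Y_\epsilon\in 0\text{-}CR$. Then $X\in 0\text{-}CR$.
   Context: All spaces are compact metric. For compact metric $X,Y$, $C(X,Y)$ is the space of continuous maps $X\to Y$ with the topology of uniform convergence, and $\hat d(f,g)=\sup_{x} d(f(x),g(x))$. A retraction $r:X\to Y$ onto a subspace $Y\subset X$ is a continuous map with $r(y)=y$ for all $y\in Y$. For $f\in C(X,X)$ and $\epsilon>0$, an $\epsilon$-chain for $f$ from $x$ to $y$ is a finite sequence $x=x_0,x_1,\dots,x_n=y$ ($n\ge 1$) in $X$ with $d(f(x_{i-1}),x_i)<\epsilon$ for $i=1,\dots,n$. A point $x$ is chain recurrent for $f$ if for each $\epsilon>0$ there is an $\epsilon$-chain for $f$ from $x$ to $x$; $CR(f)$ is the set of chain recurrent points of $f$. A property holds for a generic $f\in C(X,X)$ if the set of maps having it is residual, i.e. contains a dense $G_\delta$-subset of $C(X,X)$. The class $0\text{-}CR$ consists of all compact metric spaces $X$ such that $CR(f)$ is $0$-dimensional for a generic $f\in C(X,X)$. *)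

theory Defs
  imports "HOL-Analysis.Analysis"
begin

text \<open>
  A compact metric space is a value \<open>M :: 'a metric\<close> whose topology is compact; its subspaces
  are the values \<open>submetric M Y\<close> with \<open>Y \<subseteq> mspace M\<close>.
  The space \<open>C(M,M)\<close> with the sup metric is \<open>cfunspace (mtopology_of M) M\<close>; its elements are
  extensional, so that each continuous map of the carrier is represented by exactly one function.
\<close>

abbreviation compact_metric :: "'a metric \<Rightarrow> bool" where
  "compact_metric M \<equiv> compact_space (mtopology_of M)"

abbreviation self_maps :: "'a metric \<Rightarrow> ('a \<Rightarrow> 'a) metric" where
  "self_maps M \<equiv> cfunspace (mtopology_of M) M"

definition eps_chain :: "'a metric \<Rightarrow> ('a \<Rightarrow> 'a) \<Rightarrow> real \<Rightarrow> 'a \<Rightarrow> 'a \<Rightarrow> bool" where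
  "eps_chain M f \<epsilon> x y \<longleftrightarrow>
     (\<exists>(n::nat) c. n \<ge> 1 \<and> c 0 = x \<and> c n = y \<and> (\<forall>i\<le>n. c i \<in> mspace M) \<and>
        (\<forall>i\<in>{1..n}. mdist M (f (c (i - 1))) (c i) < \<epsilon>))"

definition chain_recurrent_set :: "'a metric \<Rightarrow> ('a \<Rightarrow> 'a) \<Rightarrow> 'a set" where
  "chain_recurrent_set M f = {x \<in> mspace M. \<forall>\<epsilon>>0. eps_chain M f \<epsilon> x x}"

definition residual_in :: "'a topology \<Rightarrow> 'a set \<Rightarrow> bool" where
  "residual_in T S \<longleftrightarrow>
     S \<subseteq> topspace T \<and> (\<exists>G. G \<subseteq> S \<and> gdelta_in T G \<and> T closure_of G = topspace T)"

definition generically :: "'a metric \<Rightarrow> (('a \<Rightarrow> 'a) \<Rightarrow> bool) \<Rightarrow> bool" where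
  "generically M P \<longleftrightarrow> residual_in (mtopology_of (self_maps M)) {f \<in> mspace (self_maps M). P f}"

text \<open>
  Dimension exactly 0, for the small inductive dimension (all the usual dimension functions agree
  on compact metric spaces). The empty space has dimension \<open>-1\<close> and is not 0-dimensional.
\<close>

definition zero_dimensional :: "'a topology \<Rightarrow> bool" where
  "zero_dimensional T \<longleftrightarrow> T dim_le 0 \<and> \<not> T dim_le (-1)"

definition zero_CR :: "'a metric \<Rightarrow> bool" where
  "zero_CR M \<longleftrightarrow>
     compact_metric M \<and>
     generically M (\<lambda>f. zero_dimensional (subtopology (mtopology_of M) (chain_recurrent_set M f)))"

end

theory Submission
  imports Defs
begin

text \<open>
  Call a set \<open>\<epsilon>\<close>-splittable if around each of its points it can be cut into two disjoint open
  pieces, the one containing the point having all mutual distances below \<open>\<epsilon>\<close>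
  (\<open>finely_split\<close>). A closed nonempty set is 0-dimensional exactly when it is
  \<open>\<epsilon>\<close>-splittable for every \<open>\<epsilon> > 0\<close> (\<open>zero_dimensional_iff_finely_split\<close>), so the theorem follows
  from two facts about the set \<open>A\<close> of self-maps of \<open>X\<close> whose chain recurrent set is splittable at
  every scale. Nonemptiness never interferes: every self-map of a nonempty compact space has a chain
  recurrent point, because some orbit accumulates somewhere (\<open>chain_recurrent_set_nonempty\<close>).

  The set \<open>A\<close> is a \<open>G\<^sub>\<delta>\<close>. For each fixed \<open>\<epsilon>\<close>, splittability of a compact set is inherited by a whole
  open neighbourhood of it (\<open>finely_split_open_neighbourhood\<close>), and \<open>CR(f)\<close> is upper semicontinuous
  in \<open>f\<close> (\<open>chain_recurrent_set_upper_semicontinuous\<close>), so the condition at scale \<open>\<epsilon>\<close> is open; \<open>A\<close>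
  is the intersection of these conditions for \<open>\<epsilon> = 1, 1/2, 1/3, \<dots>\<close>.

  The set \<open>A\<close> is dense. Given \<open>f\<close>, take a retraction \<open>r\<close> onto \<open>Y\<close> that is close to the identity and
  approximate the self-map \<open>r \<circ> f\<close> of \<open>Y\<close> by a map \<open>g\<close> with 0-dimensional chain recurrent set. Then
  \<open>g \<circ> r\<close> is a self-map of \<open>X\<close> close to \<open>f\<close>, and it has no chain recurrent points beyond those of \<open>g\<close>
  (\<open>chain_recurrent_set_comp_retraction\<close>): recurrent points lie in the closure of the image, hence in
  \<open>Y\<close>, and \<open>r\<close> carries chains in \<open>X\<close> to chains in \<open>Y\<close>.
\<close>

section \<open>Metric criteria\<close>

lemma openin_mtopology_of:
  "openin (mtopology_of M) S \<longleftrightarrow>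
    S \<subseteq> mspace M \<and> (\<forall>x\<in>S. \<exists>r>0. \<forall>y\<in>mspace M. mdist M x y < r \<longrightarrow> y \<in> S)"
proof -
  interpret Metric_space "mspace M" "mdist M" by simp
  have "mball x r \<subseteq> S \<longleftrightarrow> (\<forall>y\<in>mspace M. mdist M x y < r \<longrightarrow> y \<in> S)" if "x \<in> mspace M" for x r
    using that by auto
  then have "(\<exists>r>0. mball x r \<subseteq> S) \<longleftrightarrow> (\<exists>r>0. \<forall>y\<in>mspace M. mdist M x y < r \<longrightarrow> y \<in> S)"
    if "x \<in> mspace M" for x
    using that by simp
  then show ?thesis
    unfolding mtopology_of_def openin_mtopology by blast
qed

lemma continuous_map_mtopology_of:
  "continuous_map (mtopology_of M) (mtopology_of N) f \<longleftrightarrow>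
    f ` mspace M \<subseteq> mspace N \<and>
    (\<forall>a\<in>mspace M. \<forall>e>0. \<exists>\<delta>>0. \<forall>x\<in>mspace M. mdist M a x < \<delta> \<longrightarrow> mdist N (f a) (f x) < e)"
proof -
  interpret Metric_space "mspace M" "mdist M" by simp
  show ?thesis
    unfolding mtopology_of_def metric_continuous_map[OF Metric_space_mspace_mdist] by metis
qed

lemma closure_of_mtopology_of:
  "mtopology_of M closure_of S = {x \<in> mspace M. \<forall>r>0. \<exists>y\<in>S. y \<in> mspace M \<and> mdist M x y < r}"
proof -
  interpret Metric_space "mspace M" "mdist M" by simp
  show ?thesis
    unfolding mtopology_of_def metric_closure_of in_mball by auto
qed

lemma openin_mball_of: "openin (mtopology_of M) (mball_of M x r)"
  by (simp add: Metric_space.openin_mball mball_of_def mtopology_of_def)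

lemma mdist_self [simp]: "x \<in> mspace M \<Longrightarrow> mdist M x x = 0"
  by simp

section \<open>Perturbing chains\<close>

lemma chain_recurrent_set_subset: "chain_recurrent_set M f \<subseteq> mspace M"
  by (auto simp: chain_recurrent_set_def)

text \<open>
  The basic robustness of chain recurrence: a closed chain for a nearby map \<open>h\<close> through a nearby point
  \<open>y\<close> becomes a closed chain for \<open>f\<close> through \<open>x\<close> by moving only its two endpoints. Upper
  semicontinuity, closedness and nonemptiness of the chain recurrent set all come from it.
\<close>
lemma eps_chain_perturb:
  assumes f: "continuous_map (mtopology_of M) (mtopology_of M) f"
    and x: "x \<in> mspace M" and "\<epsilon> > 0"
  obtains \<eta> where "\<eta> > 0"
    "\<And>y h. \<lbrakk>y \<in> mspace M; mdist M x y < \<eta>;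
       \<And>z. z \<in> mspace M \<Longrightarrow> h z \<in> mspace M \<and> mdist M (f z) (h z) < \<eta>;
       eps_chain M h \<eta> y y\<rbrakk> \<Longrightarrow> eps_chain M f \<epsilon> x x"
proof -
  obtain \<delta> where "\<delta> > 0" and \<delta>: "\<And>z. z \<in> mspace M \<Longrightarrow> mdist M x z < \<delta> \<Longrightarrow> mdist M (f x) (f z) < \<epsilon>/4"
    using f[unfolded continuous_map_mtopology_of, THEN conjunct2, rule_format, OF x, of "\<epsilon>/4"] \<open>\<epsilon> > 0\<close>
    by auto
  have fM: "f z \<in> mspace M" if "z \<in> mspace M" for z
    using f that unfolding continuous_map_mtopology_of by auto
  \<comment> \<open>Each jump picks up four errors: \<open>f\<close> at a moved start, \<open>f\<close> against \<open>h\<close>, the original jump, a moved end.\<close>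
  define \<eta> where "\<eta> = min \<delta> (\<epsilon>/4)"
  have "\<eta> > 0" "\<eta> \<le> \<delta>" "\<eta> \<le> \<epsilon>/4" using \<open>\<delta> > 0\<close> \<open>\<epsilon> > 0\<close> by (auto simp: \<eta>_def)
  show thesis
  proof (rule that[OF \<open>\<eta> > 0\<close>])
    fix y h
    assume y: "y \<in> mspace M" and xy: "mdist M x y < \<eta>"
      and h: "\<And>z. z \<in> mspace M \<Longrightarrow> h z \<in> mspace M \<and> mdist M (f z) (h z) < \<eta>"
      and "eps_chain M h \<eta> y y"
    then obtain n c where n: "n \<ge> (1::nat)" and c0: "c 0 = y" and cn: "c n = y"
      and cM: "\<And>i. i \<le> n \<Longrightarrow> c i \<in> mspace M"
      and ch: "\<And>i. i \<in> {1..n} \<Longrightarrow> mdist M (h (c (i - 1))) (c i) < \<eta>"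
      unfolding eps_chain_def by metis
    define c' where "c' i = (if i = 0 \<or> i = n then x else c i)" for i
    have c'M: "c' i \<in> mspace M" if "i \<le> n" for i
      using that cM x by (auto simp: c'_def)
    have close: "mdist M (c i) (c' i) < \<eta>" if "i \<le> n" for i
      using that c0 cn xy \<open>\<eta> > 0\<close> cM[OF that] by (auto simp: c'_def mdist_commute)
    have fclose: "mdist M (f (c' i)) (f (c i)) < \<epsilon>/4" if "i \<le> n" for i
      using that c0 cn xy \<open>\<eta> \<le> \<delta>\<close> cM[OF that] fM[OF cM[OF that]] \<delta>[OF y] \<open>\<epsilon> > 0\<close>
      by (auto simp: c'_def)
    have "mdist M (f (c' (i - 1))) (c' i) < \<epsilon>" if i: "i \<in> {1..n}" for i
    proof -
      have i1: "i - 1 \<le> n" and i2: "i \<le> n" using i by auto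
      let ?a = "f (c' (i-1))" and ?b = "f (c (i-1))" and ?d = "h (c (i-1))"
      have "?a \<in> mspace M" "?b \<in> mspace M" "?d \<in> mspace M" "c i \<in> mspace M" "c' i \<in> mspace M"
        using fM cM c'M h i1 i2 by auto
      then have "mdist M ?a (c' i) \<le> mdist M ?a ?b + mdist M ?b ?d + mdist M ?d (c i) + mdist M (c i) (c' i)"
        using mdist_triangle[of ?a M ?b "c' i"] mdist_triangle[of ?b M ?d "c' i"]
          mdist_triangle[of ?d M "c i" "c' i"] by linarith
      then show ?thesis
        using fclose[OF i1] h[OF cM[OF i1]] ch[OF i] close[OF i2] \<open>\<eta> \<le> \<epsilon>/4\<close> by linarith
    qed
    then show "eps_chain M f \<epsilon> x x"
      unfolding eps_chain_def using n c'M
      by (intro exI[of _ n] exI[of _ c']) (auto simp: c'_def)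
  qed
qed

text \<open>
  By \<open>eps_chain_perturb\<close>, a point \<open>x\<close> outside \<open>CR(f)\<close> has a ball that no sufficiently near map
  can recur in; finitely many of these balls cover the compact complement of \<open>W\<close>.
\<close>
theorem chain_recurrent_set_upper_semicontinuous:
  assumes M: "compact_metric M" and f: "continuous_map (mtopology_of M) (mtopology_of M) f"
    and W: "openin (mtopology_of M) W" "chain_recurrent_set M f \<subseteq> W"
  obtains \<delta> where "\<delta> > 0"
    "\<And>h. (\<And>z. z \<in> mspace M \<Longrightarrow> h z \<in> mspace M \<and> mdist M (f z) (h z) < \<delta>)
      \<Longrightarrow> chain_recurrent_set M h \<subseteq> W"
proof -
  have "\<exists>\<eta>>0. \<forall>y h. y \<in> mspace M \<longrightarrow> mdist M x y < \<eta> \<longrightarrow>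
       (\<forall>z\<in>mspace M. h z \<in> mspace M \<and> mdist M (f z) (h z) < \<eta>) \<longrightarrow> \<not> eps_chain M h \<eta> y y"
    if x: "x \<in> mspace M - W" for x
  proof -
    have "x \<notin> chain_recurrent_set M f" using x W(2) by blast
    then obtain \<epsilon> where "\<epsilon> > 0" "\<not> eps_chain M f \<epsilon> x x"
      using x unfolding chain_recurrent_set_def by auto
    moreover have "x \<in> mspace M" using x by simp
    ultimately show ?thesis
      using eps_chain_perturb[OF f, of x \<epsilon>] by metis
  qed
  then obtain \<eta> where \<eta>: "\<And>x. x \<in> mspace M - W \<Longrightarrow> \<eta> x > 0"
    and no: "\<And>x y h. \<lbrakk>x \<in> mspace M - W; y \<in> mspace M; mdist M x y < \<eta> x;
       \<forall>z\<in>mspace M. h z \<in> mspace M \<and> mdist M (f z) (h z) < \<eta> x\<rbrakk> \<Longrightarrow> \<not> eps_chain M h (\<eta> x) y y"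
    by metis
  have "compactin (mtopology_of M) (mspace M - W)"
    using M W by (metis closedin_compact_space closedin_diff closedin_topspace topspace_mtopology_of)
  moreover have "mspace M - W \<subseteq> \<Union>((\<lambda>x. mball_of M x (\<eta> x)) ` (mspace M - W))"
  proof
    fix x assume "x \<in> mspace M - W"
    then have "x \<in> mball_of M x (\<eta> x)" using \<eta> by simp
    then show "x \<in> \<Union>((\<lambda>x. mball_of M x (\<eta> x)) ` (mspace M - W))"
      using \<open>x \<in> mspace M - W\<close> by blast
  qed
  ultimately obtain \<F> where \<F>: "finite \<F>" "\<F> \<subseteq> (\<lambda>x. mball_of M x (\<eta> x)) ` (mspace M - W)"
    "mspace M - W \<subseteq> \<Union>\<F>"
    unfolding compactin_def using openin_mball_of by (smt (verit) imageE)
  obtain F where F: "finite F" "F \<subseteq> mspace M - W" "mspace M - W \<subseteq> (\<Union>x\<in>F. mball_of M x (\<eta> x))"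
    using finite_subset_image[OF \<F>(1,2)] \<F>(3) by blast
  define \<delta> where "\<delta> = Min (insert 1 (\<eta> ` F))"
  have \<delta>: "\<delta> > 0" "\<And>x. x \<in> F \<Longrightarrow> \<delta> \<le> \<eta> x"
  proof -
    have "\<forall>x\<in>F. \<eta> x > 0" using F(2) \<eta> by blast
    then show "\<delta> > 0" unfolding \<delta>_def using F(1) by (subst Min_gr_iff) auto
    show "\<And>x. x \<in> F \<Longrightarrow> \<delta> \<le> \<eta> x" unfolding \<delta>_def using F(1) by (intro Min_le) auto
  qed
  show thesis
  proof (rule that[OF \<delta>(1)], rule subsetI)
    fix h y
    assume h: "\<And>z. z \<in> mspace M \<Longrightarrow> h z \<in> mspace M \<and> mdist M (f z) (h z) < \<delta>"
      and y: "y \<in> chain_recurrent_set M h"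
    show "y \<in> W"
    proof (rule ccontr)
      assume "y \<notin> W"
      then have "y \<in> (\<Union>x\<in>F. mball_of M x (\<eta> x))"
        using subsetD[OF F(3), of y] subsetD[OF chain_recurrent_set_subset y] by blast
      then obtain x where x: "x \<in> F" "mdist M x y < \<eta> x"
        by auto
      have "\<forall>z\<in>mspace M. h z \<in> mspace M \<and> mdist M (f z) (h z) < \<eta> x"
        using h \<delta>(2)[OF x(1)] by (meson less_le_trans)
      then have "\<not> eps_chain M h (\<eta> x) y y"
        using no x F y by (auto simp: chain_recurrent_set_def)
      then show False
        using y \<eta> x F by (auto simp: chain_recurrent_set_def)
    qed
  qed
qed

lemma closedin_chain_recurrent_set:
  assumes f: "continuous_map (mtopology_of M) (mtopology_of M) f"
  shows "closedin (mtopology_of M) (chain_recurrent_set M f)"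
proof -
  have "\<exists>r>0. \<forall>y\<in>mspace M. mdist M x y < r \<longrightarrow> y \<notin> chain_recurrent_set M f"
    if x: "x \<in> mspace M" "x \<notin> chain_recurrent_set M f" for x
  proof -
    obtain \<epsilon> where "\<epsilon> > 0" "\<not> eps_chain M f \<epsilon> x x"
      using x unfolding chain_recurrent_set_def by auto
    then obtain \<eta> where "\<eta> > 0" and \<eta>: "\<And>y h. \<lbrakk>y \<in> mspace M; mdist M x y < \<eta>;
       \<And>z. z \<in> mspace M \<Longrightarrow> h z \<in> mspace M \<and> mdist M (f z) (h z) < \<eta>\<rbrakk> \<Longrightarrow> \<not> eps_chain M h \<eta> y y"
      using eps_chain_perturb[OF f x(1)] by metis
    have "f z \<in> mspace M \<and> mdist M (f z) (f z) < \<eta>" if "z \<in> mspace M" for z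
      using f that \<open>\<eta> > 0\<close> unfolding continuous_map_mtopology_of by (auto simp: image_subset_iff)
    then have "\<not> eps_chain M f \<eta> y y" if "y \<in> mspace M" "mdist M x y < \<eta>" for y
      using \<eta> that by blast
    then show ?thesis
      using \<open>\<eta> > 0\<close> by (auto simp: chain_recurrent_set_def)
  qed
  then show ?thesis
    unfolding closedin_def openin_mtopology_of by (auto simp: chain_recurrent_set_subset)
qed

text \<open>
  Let \<open>x\<close> be a limit of a subsequence of an orbit. The orbit segment between two visits near \<open>x\<close> is a
  closed chain once its last point is replaced by the first, and it passes near \<open>x\<close>.
\<close>
lemma chain_recurrent_set_nonempty:
  assumes M: "compact_metric M" and ne: "mspace M \<noteq> {}"
    and f: "continuous_map (mtopology_of M) (mtopology_of M) f"
  shows "chain_recurrent_set M f \<noteq> {}"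
proof -
  interpret Metric_space "mspace M" "mdist M" by simp
  have fM: "f z \<in> mspace M" if "z \<in> mspace M" for z
    using f that unfolding continuous_map_mtopology_of by auto
  obtain a where a: "a \<in> mspace M" using ne by auto
  define s where "s n = (f ^^ n) a" for n
  have sM: "s n \<in> mspace M" for n
    by (induction n) (auto simp: s_def a fM)
  then obtain x r where x: "x \<in> mspace M" and r: "strict_mono r"
    and lim: "limitin mtopology (s \<circ> r) x sequentially"
    using M unfolding mtopology_of_def compact_space_sequentially
    by (metis image_subset_iff)
  have "eps_chain M f \<epsilon> x x" if "\<epsilon> > 0" for \<epsilon>
  proof -
    obtain \<eta> where "\<eta> > 0" and \<eta>: "\<And>y h. \<lbrakk>y \<in> mspace M; mdist M x y < \<eta>;
       \<And>z. z \<in> mspace M \<Longrightarrow> h z \<in> mspace M \<and> mdist M (f z) (h z) < \<eta>;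
       eps_chain M h \<eta> y y\<rbrakk> \<Longrightarrow> eps_chain M f \<epsilon> x x"
      using eps_chain_perturb[OF f x \<open>\<epsilon> > 0\<close>] by metis
    obtain N where N: "\<And>n. n \<ge> N \<Longrightarrow> mdist M (s (r n)) x < \<eta>/2"
      using lim \<open>\<eta> > 0\<close> unfolding limit_metric_sequentially
      by (metis comp_apply half_gt_zero)
    define m where "m = r (Suc N) - r N"
    have rr: "r N < r (Suc N)" using r by (simp add: strict_mono_Suc_iff)
    define y where "y = s (r N)"
    define c where "c i = (if i = m then y else s (r N + i))" for i
    have yM: "y \<in> mspace M" and xy: "mdist M x y < \<eta>"
      using sM N[of N] \<open>\<eta> > 0\<close> by (auto simp: y_def mdist_commute)
    have ret: "mdist M (s (r (Suc N))) y < \<eta>"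
      using mdist_triangle[of "s (r (Suc N))" M x y] sM x N[of N] N[of "Suc N"]
      by (auto simp: y_def mdist_commute)
    have step: "f (s k) = s (Suc k)" for k by (simp add: s_def)
    have "mdist M (f (c (i - 1))) (c i) < \<eta>" if i: "i \<in> {1..m}" for i
    proof -
      have "c (i - 1) = s (r N + (i - 1))" using i by (auto simp: c_def)
      then have "f (c (i - 1)) = s (r N + i)" using i by (simp add: step)
      then show ?thesis
        using ret rr sM \<open>\<eta> > 0\<close> by (auto simp: c_def m_def)
    qed
    then have "eps_chain M f \<eta> y y"
      unfolding eps_chain_def using rr sM yM
      by (intro exI[of _ m] exI[of _ c]) (auto simp: c_def m_def y_def)
    then show ?thesis
      using \<eta>[OF yM xy, of f] fM \<open>\<eta> > 0\<close> by simp
  qed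
  then show ?thesis
    using x by (auto simp: chain_recurrent_set_def)
qed

section \<open>Splitting a set into small pieces\<close>

text \<open>
  The separating sets \<open>U\<close> and \<open>V\<close> are open in the whole space, not merely relative to \<open>K\<close>, so that they
  still separate sets slightly larger than \<open>K\<close>.
\<close>
definition finely_split :: "'a metric \<Rightarrow> real \<Rightarrow> 'a set \<Rightarrow> bool" where
  "finely_split M \<epsilon> K \<longleftrightarrow>
    (\<forall>x\<in>K. \<exists>U V. openin (mtopology_of M) U \<and> openin (mtopology_of M) V \<and> disjnt U V \<and>
       x \<in> U \<and> K \<subseteq> U \<union> V \<and> (\<forall>y\<in>U. \<forall>z\<in>U. mdist M y z < \<epsilon>))"

lemma finely_split_subset: "finely_split M \<epsilon> K \<Longrightarrow> L \<subseteq> K \<Longrightarrow> finely_split M \<epsilon> L"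
  unfolding finely_split_def by (meson dual_order.trans subsetD)

lemma finely_split_mono: "finely_split M \<delta> K \<Longrightarrow> \<delta> \<le> \<epsilon> \<Longrightarrow> finely_split M \<epsilon> K"
  unfolding finely_split_def by (meson less_le_trans)

text \<open>
  Finitely many of the small pieces \<open>U x\<close> cover \<open>K\<close>. On the part of their union where all the
  corresponding pairs \<open>U x\<close>, \<open>V x\<close> still cover, the same pairs witness splittability.
\<close>
lemma finely_split_open_neighbourhood:
  assumes K: "compactin (mtopology_of M) K" and split: "finely_split M \<epsilon> K"
  obtains W where "openin (mtopology_of M) W" "K \<subseteq> W" "finely_split M \<epsilon> W"
proof -
  let ?T = "mtopology_of M"
  obtain U V where UV: "\<And>x. x \<in> K \<Longrightarrow> openin ?T (U x) \<and> openin ?T (V x) \<and> disjnt (U x) (V x) \<and>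
       x \<in> U x \<and> K \<subseteq> U x \<union> V x \<and> (\<forall>y\<in>U x. \<forall>z\<in>U x. mdist M y z < \<epsilon>)"
    using split unfolding finely_split_def by metis
  have "K \<subseteq> \<Union>(U ` K)" "\<forall>A\<in>U ` K. openin ?T A" using UV by auto
  then obtain \<F> where \<F>: "finite \<F>" "\<F> \<subseteq> U ` K" "K \<subseteq> \<Union>\<F>"
    using K unfolding compactin_def by meson
  obtain F where F: "finite F" "F \<subseteq> K" "K \<subseteq> \<Union>(U ` F)"
    using finite_subset_image[OF \<F>(1,2)] \<F>(3) by blast
  define W where "W = \<Union>(U ` F) \<inter> ((\<Inter>x\<in>F. U x \<union> V x) \<inter> topspace ?T)"
  have "openin ?T ((\<Inter>x\<in>F. U x \<union> V x) \<inter> topspace ?T)"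
    using F(1,2) UV by (intro openin_INT) blast+
  then have "openin ?T W"
    unfolding W_def using F UV by (intro openin_Int[OF openin_Union]) auto
  moreover have "K \<subseteq> W"
    unfolding W_def using F UV compactin_subset_topspace[OF K] by blast
  moreover have "finely_split M \<epsilon> W"
    unfolding finely_split_def
  proof
    fix y assume "y \<in> W"
    then obtain x where "x \<in> F" "y \<in> U x" "W \<subseteq> U x \<union> V x" unfolding W_def by blast
    then show "\<exists>U V. openin ?T U \<and> openin ?T V \<and> disjnt U V \<and> y \<in> U \<and> W \<subseteq> U \<union> V
        \<and> (\<forall>y\<in>U. \<forall>z\<in>U. mdist M y z < \<epsilon>)"
      using UV F by (intro exI[of _ "U x"] exI[of _ "V x"]) auto
  qed
  ultimately show thesis using that by blast
qed

text \<open>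
  A relatively clopen subset of a closed set and its relative complement are disjoint closed sets of
  the whole space, so normality separates them by open sets.
\<close>
lemma dim_le_0_imp_finely_split:
  assumes K: "closedin (mtopology_of M) K"
    and dim: "subtopology (mtopology_of M) K dim_le 0" and "\<epsilon> > 0"
  shows "finely_split M \<epsilon> K"
  unfolding finely_split_def
proof
  let ?T = "mtopology_of M"
  fix x assume "x \<in> K"
  have KM: "K \<subseteq> mspace M" using closedin_subset[OF K] by simp
  have "openin (subtopology ?T K) (K \<inter> mball_of M x (\<epsilon>/2))" "x \<in> K \<inter> mball_of M x (\<epsilon>/2)"
    using \<open>x \<in> K\<close> KM \<open>\<epsilon> > 0\<close>
    by (auto simp: openin_subtopology_Int2 openin_mball_of)
  then obtain C where C: "closedin (subtopology ?T K) C" "openin (subtopology ?T K) C"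
    "x \<in> C" "C \<subseteq> K \<inter> mball_of M x (\<epsilon>/2)"
    using dim unfolding dimension_le_0_neighbourhood_base_of_clopen
    by (subst (asm) open_neighbourhood_base_of) blast+
  have "closedin ?T C" using C(1) K by (meson closedin_trans_full)
  have "closedin (subtopology ?T K) (topspace (subtopology ?T K) - C)"
    using C(2) by blast
  then have "closedin ?T (K - C)"
    using K KM by (simp add: Int_absorb1 closedin_closed_subtopology)
  moreover have "normal_space ?T"
    unfolding mtopology_of_def by (simp add: Metric_space.normal_space_mtopology)
  ultimately obtain U V where UV: "openin ?T U" "openin ?T V" "C \<subseteq> U" "K - C \<subseteq> V" "disjnt U V"
    using \<open>closedin ?T C\<close> unfolding normal_space_def by (metis Diff_disjoint disjnt_def)
  let ?U = "U \<inter> mball_of M x (\<epsilon>/2)"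
  have "mdist M y z < \<epsilon>" if "y \<in> ?U" "z \<in> ?U" for y z
    using that mdist_triangle[of y M x z] by (auto simp: mdist_commute)
  moreover have "openin ?T ?U" using openin_Int[OF UV(1) openin_mball_of] .
  moreover have "disjnt ?U V" using UV(5) by (auto simp: disjnt_def)
  moreover have "x \<in> ?U" "K \<subseteq> ?U \<union> V" using C UV by blast+
  ultimately show "\<exists>U V. openin ?T U \<and> openin ?T V \<and> disjnt U V \<and> x \<in> U \<and> K \<subseteq> U \<union> V
        \<and> (\<forall>y\<in>U. \<forall>z\<in>U. mdist M y z < \<epsilon>)"
    using UV(2) by blast
qed

text \<open>
  The trace \<open>K \<inter> U\<close> of a small piece is relatively clopen, its relative complement being \<open>K \<inter> V\<close>.
\<close>
lemma finely_split_imp_dim_le_0: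
  assumes KM: "K \<subseteq> mspace M" and split: "\<And>\<epsilon>. \<epsilon> > 0 \<Longrightarrow> finely_split M \<epsilon> K"
  shows "subtopology (mtopology_of M) K dim_le 0"
proof -
  let ?T = "mtopology_of M" and ?S = "subtopology (mtopology_of M) K"
  have "\<exists>C. (closedin ?S C \<and> openin ?S C) \<and> x \<in> C \<and> C \<subseteq> W"
    if "openin ?S W" "x \<in> W" for W x
  proof -
    obtain G where G: "openin ?T G" "W = G \<inter> K"
      using \<open>openin ?S W\<close> unfolding openin_subtopology by auto
    then have "x \<in> G" "x \<in> K" using that by auto
    then obtain r where "r > 0" and r: "\<And>y. y \<in> mspace M \<Longrightarrow> mdist M x y < r \<Longrightarrow> y \<in> G"
      using G(1) unfolding openin_mtopology_of by metis
    obtain U V where UV: "openin ?T U" "openin ?T V" "disjnt U V" "x \<in> U" "K \<subseteq> U \<union> V"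
        "\<forall>y\<in>U. \<forall>z\<in>U. mdist M y z < r"
      using split[OF \<open>r > 0\<close>] \<open>x \<in> K\<close> unfolding finely_split_def by meson
    have "openin ?S (K \<inter> V)" "openin ?S (K \<inter> U)"
      using UV by (auto simp: openin_subtopology_Int2)
    moreover have "topspace ?S - K \<inter> U = K \<inter> V"
      using UV(3,5) KM by (auto simp: disjnt_def)
    ultimately have "closedin ?S (K \<inter> U)" "openin ?S (K \<inter> U)"
      using KM by (auto simp: closedin_def)
    moreover have "K \<inter> U \<subseteq> W" "x \<in> K \<inter> U"
      using UV r KM \<open>x \<in> K\<close> G by auto
    ultimately show ?thesis by blast
  qed
  then show ?thesis
    unfolding dimension_le_0_neighbourhood_base_of_clopen
    by (subst open_neighbourhood_base_of) blast+
qed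

lemma zero_dimensional_iff_finely_split:
  assumes K: "closedin (mtopology_of M) K"
  shows "zero_dimensional (subtopology (mtopology_of M) K) \<longleftrightarrow>
    K \<noteq> {} \<and> (\<forall>\<epsilon>>0. finely_split M \<epsilon> K)"
proof -
  have KM: "K \<subseteq> mspace M" using closedin_subset[OF K] by simp
  then have "subtopology (mtopology_of M) K = trivial_topology \<longleftrightarrow> K = {}"
    by (metis null_topspace_iff_trivial topspace_mtopology_of topspace_subtopology inf.absorb_iff2)
  then show ?thesis
    unfolding zero_dimensional_def dimension_le_eq_empty
    using dim_le_0_imp_finely_split[OF K] finely_split_imp_dim_le_0[OF KM] by blast
qed

section \<open>Spaces of self-maps\<close>

lemma mspace_self_maps:
  "compact_metric M \<Longrightarrow> f \<in> mspace (self_maps M) \<longleftrightarrow>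
    f \<in> extensional (mspace M) \<and> continuous_map (mtopology_of M) (mtopology_of M) f"
  unfolding compact_space_def
  by (subst compactin_mspace_cfunspace) (auto simp: continuous_map_mtopology_of)

lemma openin_finely_split_chain_recurrent:
  assumes M: "compact_metric M"
  shows "openin (mtopology_of (self_maps M))
    {f \<in> mspace (self_maps M). finely_split M \<epsilon> (chain_recurrent_set M f)}"
  unfolding openin_mtopology_of
proof (intro conjI ballI)
  fix f assume "f \<in> {f \<in> mspace (self_maps M). finely_split M \<epsilon> (chain_recurrent_set M f)}"
  then have f: "f \<in> mspace (self_maps M)" and split: "finely_split M \<epsilon> (chain_recurrent_set M f)"
    by blast+
  have cf: "continuous_map (mtopology_of M) (mtopology_of M) f"
    using f mspace_self_maps[OF M] by blast
  have "compactin (mtopology_of M) (chain_recurrent_set M f)"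
    using closedin_chain_recurrent_set[OF cf] M by (rule closedin_compact_space[rotated])
  then obtain W where W: "openin (mtopology_of M) W" "chain_recurrent_set M f \<subseteq> W" "finely_split M \<epsilon> W"
    using split by (rule finely_split_open_neighbourhood)
  obtain \<delta> where "\<delta> > 0" and \<delta>: "\<And>h. (\<And>z. z \<in> mspace M \<Longrightarrow> h z \<in> mspace M \<and> mdist M (f z) (h z) < \<delta>)
      \<Longrightarrow> chain_recurrent_set M h \<subseteq> W"
    using chain_recurrent_set_upper_semicontinuous[OF M cf W(1,2)] by blast
  have "finely_split M \<epsilon> (chain_recurrent_set M h)"
    if h: "h \<in> mspace (self_maps M)" and d: "mdist (self_maps M) f h < \<delta>" for h
  proof (rule finely_split_subset[OF W(3)], rule \<delta>)
    fix z assume z: "z \<in> mspace M"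
    have "h z \<in> mspace M" using h z by auto
    moreover have "mdist M (f z) (h z) < \<delta>"
      using cfunspace_mdist_lt[OF _ f h d] z M by (simp add: compact_space_def)
    ultimately show "h z \<in> mspace M \<and> mdist M (f z) (h z) < \<delta>" by blast
  qed
  then show "\<exists>r>0. \<forall>h\<in>mspace (self_maps M). mdist (self_maps M) f h < r \<longrightarrow>
      h \<in> {f \<in> mspace (self_maps M). finely_split M \<epsilon> (chain_recurrent_set M f)}"
    using \<open>\<delta> > 0\<close> by blast
qed blast

lemma gdelta_in_finely_split_chain_recurrent:
  assumes M: "compact_metric M"
  shows "gdelta_in (mtopology_of (self_maps M))
    {f \<in> mspace (self_maps M). \<forall>\<epsilon>>0. finely_split M \<epsilon> (chain_recurrent_set M f)}"
    (is "gdelta_in ?T ?A")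
proof -
  define B where "B n = {f \<in> mspace (self_maps M). finely_split M (1 / Suc n) (chain_recurrent_set M f)}" for n :: nat
  have "?A = \<Inter>(range B)"
  proof (intro equalityI subsetI)
    fix f assume "f \<in> ?A"
    then show "f \<in> \<Inter>(range B)" by (simp add: B_def del: mspace_cfunspace)
  next
    fix f assume f: "f \<in> \<Inter>(range B)"
    have "finely_split M \<epsilon> (chain_recurrent_set M f)" if "\<epsilon> > 0" for \<epsilon>
    proof -
      obtain n where "1 / Suc n < \<epsilon>" using \<open>\<epsilon> > 0\<close> by (rule nat_approx_posE)
      moreover have "f \<in> B n" using f by blast
      ultimately show ?thesis unfolding B_def using finely_split_mono by (blast intro: less_imp_le)
    qed
    moreover have "f \<in> B 0" using f by blast
    ultimately show "f \<in> ?A" unfolding B_def by blast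
  qed
  moreover have "gdelta_in ?T (\<Inter>(range B))"
    using openin_finely_split_chain_recurrent[OF M]
    by (intro gdelta_in_Inter) (auto simp: B_def open_imp_gdelta_in simp del: mspace_cfunspace)
  ultimately show ?thesis by simp
qed

section \<open>Extending a map along a retraction\<close>

text \<open>
  The point is the identity \<open>r (h z) = h z = g (r z)\<close>: applying the uniformly continuous \<open>r\<close> to a fine
  chain of \<open>h = g \<circ> r\<close> in \<open>M\<close> gives a chain of \<open>g\<close> in \<open>Y\<close>, and \<open>r\<close> fixes the endpoint because that
  lies in \<open>Y\<close>.
\<close>
lemma chain_recurrent_set_comp_retraction:
  assumes M: "compact_metric M" and YM: "Y \<subseteq> mspace M"
    and Y: "closedin (mtopology_of M) Y"
    and r: "retraction_maps (mtopology_of M) (subtopology (mtopology_of M) Y) r id"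
    and g: "g ` Y \<subseteq> Y" and h: "\<And>x. x \<in> mspace M \<Longrightarrow> h x = g (r x)"
  shows "chain_recurrent_set M h \<subseteq> chain_recurrent_set (submetric M Y) g"
proof
  fix x assume x: "x \<in> chain_recurrent_set M h"
  have rc: "continuous_map (mtopology_of M) (mtopology_of M) r"
    and rY: "\<And>z. z \<in> mspace M \<Longrightarrow> r z \<in> Y" and rid: "\<And>y. y \<in> Y \<Longrightarrow> r y = y"
    using r YM unfolding retraction_maps_def continuous_map_in_subtopology by auto
  have hY: "h z \<in> Y" if "z \<in> mspace M" for z
    using that h g rY by auto
  have xM: "x \<in> mspace M" and chain: "\<And>\<epsilon>. \<epsilon> > 0 \<Longrightarrow> eps_chain M h \<epsilon> x x"
    using x by (auto simp: chain_recurrent_set_def)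
  \<comment> \<open>The last jump of a chain ending in \<open>x\<close> starts from a value of \<open>h\<close>, which lies in \<open>Y\<close>.\<close>
  have "x \<in> mtopology_of M closure_of Y"
    unfolding closure_of_mtopology_of
  proof (intro CollectI conjI allI impI xM)
    fix \<rho> :: real assume "\<rho> > 0"
    then obtain n c where n: "n \<ge> (1::nat)" "c n = x" "\<forall>i\<le>n. c i \<in> mspace M"
        "\<forall>i\<in>{1..n}. mdist M (h (c (i - 1))) (c i) < \<rho>"
      using chain unfolding eps_chain_def by metis
    have "c (n - 1) \<in> mspace M" "mdist M (h (c (n - 1))) (c n) < \<rho>"
      using n by auto
    then show "\<exists>y\<in>Y. y \<in> mspace M \<and> mdist M x y < \<rho>"
      using hY[of "c (n-1)"] YM n(2) by (metis mdist_commute subsetD)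
  qed
  then have xY: "x \<in> Y" using Y by (simp add: closure_of_closedin)
  have "eps_chain (submetric M Y) g \<epsilon> x x" if "\<epsilon> > 0" for \<epsilon>
  proof -
    obtain \<delta> where "\<delta> > 0" and \<delta>: "\<And>u v. \<lbrakk>u \<in> mspace M; v \<in> mspace M; mdist M u v < \<delta>\<rbrakk>
        \<Longrightarrow> mdist M (r u) (r v) < \<epsilon>"
      using continuous_eq_uniformly_continuous_map[OF M, of M r] rc \<open>\<epsilon> > 0\<close>
      unfolding uniformly_continuous_map_def by metis
    obtain n c where n: "n \<ge> (1::nat)" "c 0 = x" "c n = x" "\<forall>i\<le>n. c i \<in> mspace M"
        "\<forall>i\<in>{1..n}. mdist M (h (c (i - 1))) (c i) < \<delta>"
      using chain[OF \<open>\<delta> > 0\<close>] unfolding eps_chain_def by metis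
    have "mdist M (g (r (c (i - 1)))) (r (c i)) < \<epsilon>" if i: "i \<in> {1..n}" for i
    proof -
      have "c (i - 1) \<in> mspace M" "c i \<in> mspace M" "mdist M (h (c (i - 1))) (c i) < \<delta>"
        using n i by auto
      moreover have "r (h (c (i - 1))) = g (r (c (i - 1)))"
        using rid hY h calculation(1) by metis
      ultimately show ?thesis
        using \<delta>[of "h (c (i - 1))" "c i"] hY YM by (metis subsetD)
    qed
    then show ?thesis
      unfolding eps_chain_def using n rY YM rid[OF xY]
      by (intro exI[of _ n] exI[of _ "r \<circ> c"]) auto
  qed
  then show "x \<in> chain_recurrent_set (submetric M Y) g"
    using xY xM by (simp add: chain_recurrent_set_def)
qed

lemma zero_CR_approximation:
  assumes Y: "zero_CR Y" and f: "continuous_map (mtopology_of Y) (mtopology_of Y) f" and "\<delta> > 0"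
  obtains g where "continuous_map (mtopology_of Y) (mtopology_of Y) g"
    "\<And>y. y \<in> mspace Y \<Longrightarrow> mdist Y (f y) (g y) < \<delta>"
    "zero_dimensional (subtopology (mtopology_of Y) (chain_recurrent_set Y g))"
proof -
  have cY: "compact_metric Y" using Y by (simp add: zero_CR_def)
  \<comment> \<open>Points of the function space are extensional, so \<open>f\<close> itself need not be one.\<close>
  define f' where "f' = restrict f (mspace Y)"
  have "continuous_map (mtopology_of Y) (mtopology_of Y) f'"
    using f by (rule continuous_map_eq) (simp add: f'_def)
  then have f': "f' \<in> mspace (self_maps Y)"
    using mspace_self_maps[OF cY] by (simp add: f'_def)
  obtain G where G: "G \<subseteq> {f \<in> mspace (self_maps Y).
        zero_dimensional (subtopology (mtopology_of Y) (chain_recurrent_set Y f))}"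
      "mtopology_of (self_maps Y) closure_of G = mspace (self_maps Y)"
    using Y unfolding zero_CR_def generically_def residual_in_def topspace_mtopology_of by metis
  have "f' \<in> mtopology_of (self_maps Y) closure_of G" using f' G(2) by blast
  then obtain g where g: "g \<in> G" "g \<in> mspace (self_maps Y)" "mdist (self_maps Y) f' g < \<delta>"
    unfolding closure_of_mtopology_of using \<open>\<delta> > 0\<close> by blast
  show thesis
  proof
    show "continuous_map (mtopology_of Y) (mtopology_of Y) g"
      using g(2) mspace_self_maps[OF cY] by blast
    show "zero_dimensional (subtopology (mtopology_of Y) (chain_recurrent_set Y g))"
      using g(1) G(1) by blast
    fix y assume "y \<in> mspace Y"
    then show "mdist Y (f y) (g y) < \<delta>"
      using cfunspace_mdist_lt[OF _ f' g(2,3), of y] cY by (simp add: compact_space_def f'_def)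
  qed
qed

lemma zero_dimensional_imp_nonempty: "zero_dimensional (subtopology T K) \<Longrightarrow> K \<noteq> {}"
  by (auto simp: zero_dimensional_def)

theorem theorem2p5:
  fixes X :: "'a metric"
  assumes "compact_metric X"
    and "\<And>\<epsilon>::real. \<epsilon> > 0 \<Longrightarrow>
      \<exists>Y r. Y \<subseteq> mspace X \<and>
        retraction_maps (mtopology_of X) (subtopology (mtopology_of X) Y) r id \<and>
        (SUP x\<in>mspace X. mdist X (r x) x) < \<epsilon> \<and>
        zero_CR (submetric X Y)"
  shows "zero_CR X"
proof -
  let ?T = "mtopology_of X" and ?C = "self_maps X"
  let ?A = "{f \<in> mspace ?C. \<forall>\<epsilon>>0. finely_split X \<epsilon> (chain_recurrent_set X f)}"
  note X = assms(1)
  have dense: "\<exists>h\<in>?A. mdist ?C f h < \<rho>" if f: "f \<in> mspace ?C" and "\<rho> > 0" for f \<rho>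
  proof -
    have cf: "continuous_map ?T ?T f" using f mspace_self_maps[OF X] by blast
    have fX: "f z \<in> mspace X" if "z \<in> mspace X" for z
      using cf that unfolding continuous_map_mtopology_of by auto
    obtain \<delta>0 where "\<delta>0 > 0" and \<delta>0: "\<And>u v. \<lbrakk>u \<in> mspace X; v \<in> mspace X; mdist X u v < \<delta>0\<rbrakk>
        \<Longrightarrow> mdist X (f u) (f v) < \<rho>/4"
      using continuous_eq_uniformly_continuous_map[OF X, of X f] cf \<open>\<rho> > 0\<close>
      unfolding uniformly_continuous_map_def by (metis zero_less_divide_iff zero_less_numeral)
    \<comment> \<open>The path from \<open>f z\<close> over \<open>f (r z)\<close> and \<open>r (f (r z))\<close> to \<open>g (r z)\<close> has three steps below \<open>\<rho>/4\<close>;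
      the spare quarter keeps the supremum distance strictly below \<open>\<rho>\<close>.\<close>
    define \<delta> where "\<delta> = min \<delta>0 (\<rho>/4)"
    have \<delta>: "\<delta> > 0" "\<delta> \<le> \<delta>0" "\<delta> \<le> \<rho>/4" using \<open>\<delta>0 > 0\<close> \<open>\<rho> > 0\<close> by (auto simp: \<delta>_def)
    obtain Y r where YX: "Y \<subseteq> mspace X" and r: "retraction_maps ?T (subtopology ?T Y) r id"
      and near: "(SUP x\<in>mspace X. mdist X (r x) x) < \<delta>" and Y: "zero_CR (submetric X Y)"
      using assms(2)[OF \<open>\<delta> > 0\<close>] by blast
    have TY: "mtopology_of (submetric X Y) = subtopology ?T Y" by (rule mtopology_of_submetric)
    have mY: "mspace (submetric X Y) = Y" using YX by auto
    have rc: "continuous_map ?T (subtopology ?T Y) r"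
      and rY: "\<And>z. z \<in> mspace X \<Longrightarrow> r z \<in> Y"
      using r YX unfolding retraction_maps_def continuous_map_in_subtopology by auto
    have "compactin ?T Y"
      using Y YX unfolding zero_CR_def TY by (simp add: compactin_subspace)
    moreover have "Hausdorff_space ?T"
      unfolding mtopology_of_def by (simp add: Metric_space.Hausdorff_space_mtopology)
    ultimately have clY: "closedin ?T Y" by (rule compactin_imp_closedin[rotated])
    \<comment> \<open>A real supremum bounds its members only if they are bounded, which compactness provides.\<close>
    have rnear: "mdist X (r z) z < \<delta>" if z: "z \<in> mspace X" for z
    proof -
      interpret Metric_space "mspace X" "mdist X" by simp
      have "mbounded (mspace X)"
        using X compactin_imp_mbounded unfolding compact_space_def mtopology_of_def by simp
      then obtain B where "\<And>u v. u \<in> mspace X \<Longrightarrow> v \<in> mspace X \<Longrightarrow> mdist X u v \<le> B"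
        unfolding mbounded_alt by blast
      then have "bdd_above ((\<lambda>x. mdist X (r x) x) ` mspace X)"
        using rY YX by (intro bdd_aboveI2) blast
      then show ?thesis using cSUP_upper[OF z] near by (meson le_less_trans)
    qed
    have "continuous_map (mtopology_of (submetric X Y)) (mtopology_of (submetric X Y)) (r \<circ> f)"
      unfolding TY using continuous_map_compose[OF cf rc] by (rule continuous_map_from_subtopology)
    then obtain g where g: "continuous_map (subtopology ?T Y) (subtopology ?T Y) g"
      and gnear: "\<And>y. y \<in> Y \<Longrightarrow> mdist X (r (f y)) (g y) < \<delta>"
      and gdim: "zero_dimensional (subtopology (mtopology_of (submetric X Y)) (chain_recurrent_set (submetric X Y) g))"
      using zero_CR_approximation[OF Y _ \<open>\<delta> > 0\<close>] unfolding mY TY mdist_submetric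
      by (metis comp_apply)
    have gY: "g ` Y \<subseteq> Y"
      using g YX unfolding continuous_map_def by (auto simp: Pi_iff)
    let ?K = "chain_recurrent_set (submetric X Y) g"
    have "closedin (subtopology ?T Y) ?K"
      using closedin_chain_recurrent_set[of "submetric X Y" g] g unfolding TY by blast
    then have clK: "closedin ?T ?K" and KY: "?K \<subseteq> Y"
      using clY closedin_trans_full closedin_subset by fastforce+
    have "subtopology (mtopology_of (submetric X Y)) ?K = subtopology ?T ?K"
      using KY by (simp add: TY subtopology_subtopology Int_absorb1)
    then have Ksplit: "\<forall>\<epsilon>>0. finely_split X \<epsilon> ?K"
      using gdim zero_dimensional_iff_finely_split[OF clK] by simp
    define h where "h = restrict (g \<circ> r) (mspace X)"
    have "continuous_map ?T ?T (g \<circ> r)"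
      using continuous_map_compose[OF rc g] by (rule continuous_map_into_fulltopology)
    then have "continuous_map ?T ?T h"
      by (rule continuous_map_eq) (simp add: h_def)
    then have h: "h \<in> mspace ?C"
      using mspace_self_maps[OF X] by (simp add: h_def)
    have "chain_recurrent_set X h \<subseteq> ?K"
      using chain_recurrent_set_comp_retraction[OF X YX clY r gY] by (simp add: h_def)
    then have "h \<in> ?A"
      using h Ksplit finely_split_subset by blast
    moreover have "mdist ?C f h \<le> 3 * (\<rho>/4)"
    proof (rule mdist_cfunspace_le)
      fix z assume "z \<in> topspace ?T"
      then have z: "z \<in> mspace X" by simp
      have rX: "r u \<in> mspace X" if "u \<in> mspace X" for u
        using rY[OF that] YX by blast
      have in_X: "r z \<in> mspace X" "f z \<in> mspace X" "f (r z) \<in> mspace X" "r (f (r z)) \<in> mspace X" "h z \<in> mspace X"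
      proof -
        show "r z \<in> mspace X" "f z \<in> mspace X" using rX fX z by blast+
        show "f (r z) \<in> mspace X" "r (f (r z)) \<in> mspace X" using rX fX z by blast+
        have "g (r z) \<in> mspace X" using rY[OF z] gY YX by blast
        then show "h z \<in> mspace X" using z by (simp add: h_def)
      qed
      have "mdist X (f z) (f (r z)) < \<rho>/4"
        using \<delta>0[OF z in_X(1)] rnear[OF z] \<delta>(2) by (simp add: mdist_commute)
      moreover have "mdist X (f (r z)) (r (f (r z))) < \<rho>/4"
        using rnear[OF in_X(3)] \<delta>(3) by (simp add: mdist_commute)
      moreover have "mdist X (r (f (r z))) (h z) < \<rho>/4"
        using gnear[OF rY[OF z]] \<delta>(3) z by (simp add: h_def)
      ultimately show "mdist X (f z) (h z) \<le> 3 * (\<rho>/4)"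
        using mdist_triangle[OF in_X(2,3,5)] mdist_triangle[OF in_X(3,4,5)] by linarith
    qed (use \<open>\<rho> > 0\<close> in simp)
    ultimately show ?thesis using \<open>\<rho> > 0\<close> by (intro bexI[of _ h]) auto
  qed
  have closure: "mtopology_of ?C closure_of ?A = topspace (mtopology_of ?C)"
    unfolding closure_of_mtopology_of topspace_mtopology_of using dense by blast
  \<comment> \<open>The empty space is excluded because 0-dimensional means dimension exactly 0: a map with
    0-dimensional chain recurrent set lives on a nonempty space.\<close>
  have "mspace X \<noteq> {}"
  proof -
    obtain Y where Y: "zero_CR (submetric X Y)" using assms(2)[of 1] by auto
    obtain g where "zero_dimensional (subtopology (mtopology_of (submetric X Y)) (chain_recurrent_set (submetric X Y) g))"
      using zero_CR_approximation[OF Y continuous_map_id, of 1] by (metis zero_less_one)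
    then show ?thesis
      using zero_dimensional_imp_nonempty chain_recurrent_set_subset[of "submetric X Y" g] by fastforce
  qed
  have sub: "?A \<subseteq> {f \<in> mspace ?C. zero_dimensional (subtopology ?T (chain_recurrent_set X f))}"
  proof
    fix f assume f: "f \<in> ?A"
    then have cf: "continuous_map ?T ?T f" using mspace_self_maps[OF X] by blast
    have "zero_dimensional (subtopology ?T (chain_recurrent_set X f))"
      using f chain_recurrent_set_nonempty[OF X \<open>mspace X \<noteq> {}\<close> cf]
        zero_dimensional_iff_finely_split[OF closedin_chain_recurrent_set[OF cf]] by blast
    then show "f \<in> {f \<in> mspace ?C. zero_dimensional (subtopology ?T (chain_recurrent_set X f))}"
      using f by blast
  qed
  show ?thesis
    unfolding zero_CR_def generically_def residual_in_def topspace_mtopology_of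
  proof (intro conjI exI[of _ ?A])
    show "mtopology_of ?C closure_of ?A = mspace ?C"
      using closure unfolding topspace_mtopology_of .
  qed (rule X sub gdelta_in_finely_split_chain_recurrent[OF X] Collect_restrict)+
qed

end
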